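(* Let $(V,\mathcal{B})$ be a Mendelsohn triple system, let $L$ be the associated Mendelsohn loop and let $u\in V$. Then $u\in N(L)$ if and only if for any two distinct elements $x,y\in V\setminus\{u\}$ either $\{(x,u,y),(u,x,y)\}\subseteq\mathcal{B}$ or there exist elements $v,w,z\in V$ such that $\{(x,u,v),(u,y,w),(v,y,z),(x,w,z)\}\subseteq\mathcal{B}$.
   Context: A cyclic triple on a set $V$, denoted $(x,y,z)$, or equivalently $(y,z,x)$ or $(z,x,y)$, is the set of ordered pairs $(x,y)$, $(y,z)$, $(z,x)$ for distinct points $x,y,z\in V$. A Mendelsohn triple system is a pair $(V,\mathcal{B})$ where $\mathcal{B}$ is a collection of cyclic triples of distinct points of $V$ such that every ordered pair of distinct points of $V$ appears in precisely one triple of $\mathcal{B}$. The associated Mendelsohn loop is $L=V\cup\{e\}$, where $e\notin V$ is the identity element, with $x\cdot x=e$ for all $x$, and $x\cdot y=z$ for distinct $x,y\in V$, where $z$ is the third element of the cyclic triple of $\mathcal{B}$ containing the ordered pair $(x,y)$ (i.e. $(x,y,z)\in\mathcal{B}$). Juxtaposition denotes the operation with higher precedence. The nucleus is $N(L)=N_\lambda(L)\cap N_\mu(L)\cap N_\rho(L)$, where $N_\lambda(L)=\{u\in L: u\cdot xy = ux\cdot y \text{ for all } x,y\in L\}$, $N_\mu(L)=\{u\in L: x\cdot uy = xu\cdot y \text{ for all } x,y\in L\}$, $N_\rho(L)=\{u\in L: x\cdot yu = xy\cdot u \text{ for all } x,y\in L\}$. *)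

theory Defs
  imports "HOL-Algebra.Group"
begin

text \<open>
  A cyclic triple is the set of its three ordered pairs, so the rotations
  \<open>(x,y,z)\<close>, \<open>(y,z,x)\<close> and \<open>(z,x,y)\<close> denote the same object. Distinctness of the
  three points is not built into the notation; it is imposed on the blocks below.
\<close>

definition cyclic_triple :: "'a \<Rightarrow> 'a \<Rightarrow> 'a \<Rightarrow> ('a \<times> 'a) set" where
  "cyclic_triple x y z = {(x, y), (y, z), (z, x)}"

definition cyclic_triples_on :: "'a set \<Rightarrow> ('a \<times> 'a) set set" where
  "cyclic_triples_on V =
     {cyclic_triple x y z | x y z. x \<in> V \<and> y \<in> V \<and> z \<in> V \<and> x \<noteq> y \<and> y \<noteq> z \<and> z \<noteq> x}"

definition mendelsohn_triple_system :: "'a set \<Rightarrow> ('a \<times> 'a) set set \<Rightarrow> bool" where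
  "mendelsohn_triple_system V B \<longleftrightarrow>
     B \<subseteq> cyclic_triples_on V \<and>
     (\<forall>x\<in>V. \<forall>y\<in>V. x \<noteq> y \<longrightarrow> (\<exists>!T. T \<in> B \<and> (x, y) \<in> T))"

text \<open>
  The record type \<open>monoid\<close> serves only as a carrier with a binary operation and a
  distinguished element; Mendelsohn loops are in general not associative. The operation
  is meaningful when \<open>e \<notin> V\<close> and both arguments lie in the carrier.
\<close>

definition mendelsohn_loop :: "'a set \<Rightarrow> ('a \<times> 'a) set set \<Rightarrow> 'a \<Rightarrow> 'a monoid" where
  "mendelsohn_loop V B e =
     \<lparr>carrier = V \<union> {e},
      mult = (\<lambda>x y. if x = y then e
                    else if x = e then y
                    else if y = e then x
                    else (THE z. cyclic_triple x y z \<in> B)),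
      one = e\<rparr>"

definition left_nucleus :: "('a, 'b) monoid_scheme \<Rightarrow> 'a set" where
  "left_nucleus L = {u \<in> carrier L. \<forall>x\<in>carrier L. \<forall>y\<in>carrier L.
     u \<otimes>\<^bsub>L\<^esub> (x \<otimes>\<^bsub>L\<^esub> y) = (u \<otimes>\<^bsub>L\<^esub> x) \<otimes>\<^bsub>L\<^esub> y}"

definition middle_nucleus :: "('a, 'b) monoid_scheme \<Rightarrow> 'a set" where
  "middle_nucleus L = {u \<in> carrier L. \<forall>x\<in>carrier L. \<forall>y\<in>carrier L.
     x \<otimes>\<^bsub>L\<^esub> (u \<otimes>\<^bsub>L\<^esub> y) = (x \<otimes>\<^bsub>L\<^esub> u) \<otimes>\<^bsub>L\<^esub> y}"

definition right_nucleus :: "('a, 'b) monoid_scheme \<Rightarrow> 'a set" where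
  "right_nucleus L = {u \<in> carrier L. \<forall>x\<in>carrier L. \<forall>y\<in>carrier L.
     x \<otimes>\<^bsub>L\<^esub> (y \<otimes>\<^bsub>L\<^esub> u) = (x \<otimes>\<^bsub>L\<^esub> y) \<otimes>\<^bsub>L\<^esub> u}"

definition nucleus :: "('a, 'b) monoid_scheme \<Rightarrow> 'a set" where
  "nucleus L = left_nucleus L \<inter> middle_nucleus L \<inter> right_nucleus L"

end

theory Submission
  imports Defs
begin

text \<open>
  The operation of a Mendelsohn loop is semisymmetric, \<open>x \<cdot> yx = y\<close>: rotating a block
  does not change it. Every element squares to the identity, because of which an element of
  the nucleus commutes with everything: \<open>u \<cdot> ux = uu \<cdot> x = x = u \<cdot> xu\<close>, and \<open>u\<close> cancels.
  Conversely, semisymmetry lets the three positions of \<open>u\<close> in an associativity law be rotated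
  into each other as soon as \<open>u\<close> commutes with everything. So \<open>u\<close> is nuclear iff it commutes
  with every element and \<open>x \<cdot> uy = xu \<cdot> y\<close> holds for all \<open>x\<close> and \<open>y\<close>.

  The remaining point is to read this off from pairs of distinct \<open>x, y\<close> in \<open>V - {u}\<close>. If
  \<open>xu \<noteq> y\<close>, then all four products in \<open>x \<cdot> uy = xu \<cdot> y\<close> are products of distinct points, and
  the law is the configuration of four blocks. If \<open>xu = y\<close>, then also \<open>uy = x\<close>, both sides of
  the law are the identity, and four such blocks cannot exist because \<open>(v,y,z)\<close> with \<open>v = y\<close>
  is degenerate. In that case the condition demands \<open>ux = y\<close> instead, which is commutativity of
  \<open>u\<close> with \<open>x\<close>. As \<open>y = xu\<close> is admissible for every \<open>x\<close> in \<open>V - {u}\<close>, the exceptional pairs together express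
  exactly that \<open>u\<close> commutes with every element.
\<close>

text \<open>
  A Mendelsohn loop stripped of its triple system. The right identity law and the second
  semisymmetric law follow from these axioms.
\<close>

locale semisymmetric_loop_exponent_two =
  fixes L (structure)
  assumes one_closed [simp]: "\<one> \<in> carrier L"
    and mult_closed [simp]: "x \<in> carrier L \<Longrightarrow> y \<in> carrier L \<Longrightarrow> x \<otimes> y \<in> carrier L"
    and left_one [simp]: "x \<in> carrier L \<Longrightarrow> \<one> \<otimes> x = x"
    and square [simp]: "x \<in> carrier L \<Longrightarrow> x \<otimes> x = \<one>"
    and semisymmetric [simp]: "x \<in> carrier L \<Longrightarrow> y \<in> carrier L \<Longrightarrow> x \<otimes> (y \<otimes> x) = y"
begin

lemma semisymmetric' [simp]:
  assumes "x \<in> carrier L" "y \<in> carrier L"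
  shows "(x \<otimes> y) \<otimes> x = y"
  using semisymmetric[of "x \<otimes> y" y] assms by simp

lemma right_one [simp]: "x \<in> carrier L \<Longrightarrow> x \<otimes> \<one> = x"
  by (metis left_one mult_closed one_closed semisymmetric)

lemma rotate_product:
  assumes "x \<in> carrier L" "y \<in> carrier L" "z \<in> carrier L"
  shows "x \<otimes> y = z \<longleftrightarrow> y \<otimes> z = x"
  using assms by auto

lemma left_nucleus_commutes:
  assumes "u \<in> left_nucleus L" "x \<in> carrier L"
  shows "u \<otimes> x = x \<otimes> u"
proof -
  have u: "u \<in> carrier L" and "u \<otimes> (u \<otimes> x) = (u \<otimes> u) \<otimes> x"
    using assms by (auto simp: left_nucleus_def)
  then have "u \<otimes> (u \<otimes> x) = x"
    using assms by simp
  then show ?thesis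
    using u assms semisymmetric'[of u "u \<otimes> x"] by simp
qed

text \<open>
  Put \<open>p = xu \<cdot> y = x \<cdot> uy\<close>. By semisymmetry \<open>p \<cdot> xu = y\<close> and \<open>px = uy\<close>; as \<open>u\<close> commutes with
  \<open>y\<close>, the latter gives \<open>px \<cdot> u = y\<close> too. Every pair \<open>p, x\<close> arises in this way, so \<open>u\<close> lies in
  the right nucleus. Semisymmetry also gives \<open>yp = xu\<close> and \<open>x = uy \<cdot> p\<close>, so
  \<open>u \<cdot> yp = u \<cdot> xu = x = uy \<cdot> p\<close>; every pair \<open>y, p\<close> arises, so \<open>u\<close> lies in the left nucleus.
\<close>

lemma commuting_middle_nucleus_subset_nucleus:
  assumes mid: "u \<in> middle_nucleus L"
    and comm: "\<And>x. x \<in> carrier L \<Longrightarrow> u \<otimes> x = x \<otimes> u"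
  shows "u \<in> nucleus L"
proof -
  have u: "u \<in> carrier L"
    and assoc: "\<And>x y. x \<in> carrier L \<Longrightarrow> y \<in> carrier L \<Longrightarrow> x \<otimes> (u \<otimes> y) = (x \<otimes> u) \<otimes> y"
    using mid by (auto simp: middle_nucleus_def)
  have "p \<otimes> (x \<otimes> u) = (p \<otimes> x) \<otimes> u" if p: "p \<in> carrier L" and x: "x \<in> carrier L" for p x
  proof -
    define y where "y = p \<otimes> (x \<otimes> u)"
    have y: "y \<in> carrier L" using p x u by (simp add: y_def)
    have "p = (x \<otimes> u) \<otimes> y" using p x u by (simp add: y_def)
    then have "p \<otimes> x = u \<otimes> y"
      using assoc[OF x y] x y u by (metis mult_closed semisymmetric')
    then show ?thesis using y u by (simp add: y_def)
  qed
  moreover have "u \<otimes> (y \<otimes> p) = (u \<otimes> y) \<otimes> p" if y: "y \<in> carrier L" and p: "p \<in> carrier L" for y p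
  proof -
    define x where "x = (u \<otimes> y) \<otimes> p"
    have x: "x \<in> carrier L" using y p u by (simp add: x_def)
    have "p = x \<otimes> (u \<otimes> y)" using p y u by (simp add: x_def)
    then have "y \<otimes> p = x \<otimes> u"
      using assoc[OF x y] x y u by simp
    then show ?thesis using x u by (simp add: x_def)
  qed
  ultimately show ?thesis
    using mid u by (simp add: nucleus_def left_nucleus_def right_nucleus_def)
qed

text \<open>
  The conditional separates the pairs for which the middle associativity law is vacuous, as both
  sides are the identity; these pairs carry commutativity instead.
\<close>

lemma nucleus_iff_distinct_pairs:
  assumes u: "u \<in> carrier L" "u \<noteq> \<one>"
  shows "u \<in> nucleus L \<longleftrightarrow>
    (\<forall>x \<in> carrier L - {\<one>, u}. \<forall>y \<in> carrier L - {\<one>, u}. x \<noteq> y \<longrightarrow>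
      (if x \<otimes> u = y then u \<otimes> x = y else x \<otimes> (u \<otimes> y) = (x \<otimes> u) \<otimes> y))"
    (is "_ \<longleftrightarrow> ?pairs")
proof
  assume "u \<in> nucleus L"
  then have "u \<in> left_nucleus L" "u \<in> middle_nucleus L"
    by (auto simp: nucleus_def)
  then show ?pairs
    using left_nucleus_commutes by (auto simp: middle_nucleus_def)
next
  assume pairs: ?pairs
  have comm: "u \<otimes> x = x \<otimes> u" if x: "x \<in> carrier L" for x
  proof (cases "x = \<one> \<or> x = u")
    case True
    then show ?thesis using u by auto
  next
    case False
    \<comment> \<open>The partner \<open>y = x \<otimes> u\<close> is admissible: a value \<open>\<one>\<close>, \<open>u\<close> or \<open>x\<close> would make two of
        \<open>x\<close>, \<open>u\<close>, \<open>\<one>\<close> equal.\<close>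
    have "x \<otimes> u \<noteq> \<one>" "x \<otimes> u \<noteq> u" "x \<otimes> u \<noteq> x"
      using False u x rotate_product[of x u] rotate_product[of u x x] by auto
    then show ?thesis using pairs False u x by auto
  qed
  have "x \<otimes> (u \<otimes> y) = (x \<otimes> u) \<otimes> y" if x: "x \<in> carrier L" and y: "y \<in> carrier L" for x y
  proof -
    consider "x = \<one> \<or> y = \<one> \<or> x = y" | "x = u \<or> y = u" | "x \<otimes> u = y"
      | "x \<notin> {\<one>, u, y}" "y \<notin> {\<one>, u}" "x \<otimes> u \<noteq> y"
      by blast
    then show ?thesis
    proof cases
      case 1
      then show ?thesis using u x y by auto
    next
      case 2
      have "(x \<otimes> u) \<otimes> u = x"
        using comm[OF x, symmetric] u x by simp
      then show ?thesis using 2 u x y comm by auto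
    next
      case 3
      then have "u \<otimes> y = x" using u x by auto
      then show ?thesis using 3 x y by simp
    next
      case 4
      then show ?thesis using pairs x y by auto
    qed
  qed
  then have "u \<in> middle_nucleus L"
    using u by (simp add: middle_nucleus_def)
  then show "u \<in> nucleus L"
    using comm by (rule commuting_middle_nucleus_subset_nucleus)
qed

end

lemma cyclic_triple_rotate: "cyclic_triple x y z = cyclic_triple y z x"
  by (auto simp: cyclic_triple_def)

lemma cyclic_triple_inject:
  assumes "cyclic_triple x y z = cyclic_triple x y z'" "x \<noteq> y"
  shows "z = z'"
  using assms by (auto simp: cyclic_triple_def doubleton_eq_iff insert_eq_iff)

lemma mendelsohn_block_distinct:
  assumes "mendelsohn_triple_system V B" "cyclic_triple x y z \<in> B"
  shows "x \<in> V" "y \<in> V" "z \<in> V" "x \<noteq> y" "y \<noteq> z" "z \<noteq> x"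
proof -
  have "cyclic_triple x y z \<in> cyclic_triples_on V"
    using assms by (auto simp: mendelsohn_triple_system_def)
  then obtain a b c where "cyclic_triple x y z = cyclic_triple a b c"
    and "a \<in> V" "b \<in> V" "c \<in> V" "a \<noteq> b" "b \<noteq> c" "c \<noteq> a"
    by (auto simp: cyclic_triples_on_def)
  then have "cyclic_triple x y z \<subseteq> {(p, q). p \<in> V \<and> q \<in> V \<and> p \<noteq> q}"
    by (auto simp: cyclic_triple_def)
  then show "x \<in> V" "y \<in> V" "z \<in> V" "x \<noteq> y" "y \<noteq> z" "z \<noteq> x"
    by (auto simp: cyclic_triple_def)
qed

lemma mendelsohn_third_point:
  assumes mts: "mendelsohn_triple_system V B" and "x \<in> V" "y \<in> V" "x \<noteq> y"
  shows "\<exists>!z. cyclic_triple x y z \<in> B"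
proof -
  have unique: "\<exists>!T. T \<in> B \<and> (x, y) \<in> T" and B: "B \<subseteq> cyclic_triples_on V"
    using assms by (auto simp: mendelsohn_triple_system_def)
  obtain T where T: "T \<in> B" "(x, y) \<in> T"
    using unique by blast
  obtain a b c where "T = cyclic_triple a b c"
    using B T by (auto simp: cyclic_triples_on_def)
  then have "\<exists>z. T = cyclic_triple x y z"
    using T(2) by (auto simp: cyclic_triple_def)
  then show ?thesis
  proof (rule exE, intro ex1I)
    fix z assume "T = cyclic_triple x y z"
    then show z: "cyclic_triple x y z \<in> B"
      using T by simp
    fix z' assume "cyclic_triple x y z' \<in> B"
    moreover have "(x, y) \<in> cyclic_triple x y z" "(x, y) \<in> cyclic_triple x y z'"
      by (simp_all add: cyclic_triple_def)
    ultimately have "cyclic_triple x y z' = cyclic_triple x y z"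
      using unique z by blast
    then show "z' = z"
      using \<open>x \<noteq> y\<close> by (rule cyclic_triple_inject)
  qed
qed

text \<open>
  This dictionary replaces every block in the condition by an equation in the loop. The
  inequality on the right is essential, since the loop product is also defined for \<open>x = y\<close>.
\<close>

lemma mendelsohn_block_iff_mult:
  assumes mts: "mendelsohn_triple_system V B" and "e \<notin> V" "x \<in> V" "y \<in> V"
  shows "cyclic_triple x y z \<in> B \<longleftrightarrow> x \<noteq> y \<and> mult (mendelsohn_loop V B e) x y = z"
proof (cases "x = y")
  case True
  then show ?thesis using mendelsohn_block_distinct[OF mts] by blast
next
  case False
  have "mult (mendelsohn_loop V B e) x y = (THE z. cyclic_triple x y z \<in> B)"
    using assms False by (auto simp: mendelsohn_loop_def)
  moreover have third: "\<exists>!z. cyclic_triple x y z \<in> B"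
    using mts assms(3,4) False by (rule mendelsohn_third_point)
  ultimately show ?thesis
    using False theI'[OF third] by auto
qed

lemma mendelsohn_loop_semisymmetric:
  assumes mts: "mendelsohn_triple_system V B" and e: "e \<notin> V"
  shows "semisymmetric_loop_exponent_two (mendelsohn_loop V B e)"
proof -
  let ?L = "mendelsohn_loop V B e"
  have degenerate: "mult ?L x x = e" "mult ?L e x = x" "mult ?L x e = x" for x
    by (auto simp: mendelsohn_loop_def)
  have block: "cyclic_triple x y (mult ?L x y) \<in> B" if "x \<in> V" "y \<in> V" "x \<noteq> y" for x y
    using mendelsohn_block_iff_mult[OF mts e that(1,2)] that(3) by blast
  have semisym: "mult ?L x (mult ?L y x) = y" if "x \<in> V" "y \<in> V" "x \<noteq> y" for x y
  proof -
    let ?z = "mult ?L y x"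
    have "cyclic_triple x ?z y \<in> B"
      using block[of y x] that cyclic_triple_rotate[of y x ?z] by simp
    moreover from this have "?z \<in> V"
      by (rule mendelsohn_block_distinct[OF mts])
    ultimately show ?thesis
      using mendelsohn_block_iff_mult[OF mts e] that by blast
  qed
  have closed: "mult ?L x y \<in> V" if "x \<in> V" "y \<in> V" "x \<noteq> y" for x y
    using mendelsohn_block_distinct(3)[OF mts block[OF that]] .
  have carrier: "carrier ?L = insert e V" and one: "one ?L = e"
    by (auto simp: mendelsohn_loop_def)
  show ?thesis
  proof
    fix x y assume "x \<in> carrier ?L" "y \<in> carrier ?L"
    then show "mult ?L x y \<in> carrier ?L"
      using degenerate closed by (cases "x = y") (auto simp: carrier)
    show "mult ?L x (mult ?L y x) = y"
      using \<open>x \<in> carrier ?L\<close> \<open>y \<in> carrier ?L\<close> degenerate semisym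
      by (cases "x = y") (auto simp: carrier)
  qed (auto simp: carrier one degenerate)
qed

theorem proposition2p5:
  fixes V :: "'a set" and B :: "('a \<times> 'a) set set" and e u :: 'a
  assumes "mendelsohn_triple_system V B"
    and "e \<notin> V"
    and "u \<in> V"
  shows "u \<in> nucleus (mendelsohn_loop V B e) \<longleftrightarrow>
    (\<forall>x \<in> V - {u}. \<forall>y \<in> V - {u}. x \<noteq> y \<longrightarrow>
      {cyclic_triple x u y, cyclic_triple u x y} \<subseteq> B \<or>
      (\<exists>v\<in>V. \<exists>w\<in>V. \<exists>z\<in>V.
        {cyclic_triple x u v, cyclic_triple u y w, cyclic_triple v y z, cyclic_triple x w z} \<subseteq> B))"
proof -
  let ?L = "mendelsohn_loop V B e"
  interpret semisymmetric_loop_exponent_two ?L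
    using assms(1,2) by (rule mendelsohn_loop_semisymmetric)
  note block_iff = mendelsohn_block_iff_mult[OF assms(1,2)]
  note in_V = mendelsohn_block_distinct(3)[OF assms(1)]
  have carrier: "carrier ?L = insert e V" and one: "one ?L = e"
    by (auto simp: mendelsohn_loop_def)
  have pair: "({cyclic_triple x u y, cyclic_triple u x y} \<subseteq> B \<or>
      (\<exists>v\<in>V. \<exists>w\<in>V. \<exists>z\<in>V.
        {cyclic_triple x u v, cyclic_triple u y w, cyclic_triple v y z, cyclic_triple x w z} \<subseteq> B))
    \<longleftrightarrow> (if mult ?L x u = y then mult ?L u x = y
         else mult ?L x (mult ?L u y) = mult ?L (mult ?L x u) y)"
    (is "?commute \<or> ?configuration \<longleftrightarrow> ?law")
    if x: "x \<in> V" "x \<noteq> u" and y: "y \<in> V" "y \<noteq> u" for x y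
  proof -
    let ?v = "mult ?L x u" and ?w = "mult ?L u y"
    have V: "?v \<in> V" "?w \<in> V"
      using in_V block_iff x y \<open>u \<in> V\<close> by metis+
    have degenerate: "?v = y \<longleftrightarrow> x = ?w"
      using rotate_product[of x u y] x y \<open>u \<in> V\<close> by (auto simp: carrier)
    have commute: "?commute \<longleftrightarrow> ?v = y \<and> mult ?L u x = y"
      using block_iff x y \<open>u \<in> V\<close> by auto
    have "?configuration \<longleftrightarrow>
        (\<exists>z\<in>V. cyclic_triple ?v y z \<in> B \<and> cyclic_triple x ?w z \<in> B)"
      using block_iff x y \<open>u \<in> V\<close> V by auto
    also have "\<dots> \<longleftrightarrow> ?v \<noteq> y \<and> x \<noteq> ?w \<and> mult ?L x ?w = mult ?L ?v y"
      using block_iff[OF V(1) y(1)] block_iff[OF x(1) V(2)] in_V by metis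
    finally show ?thesis
      using commute degenerate by auto
  qed
  have "u \<in> nucleus ?L \<longleftrightarrow>
    (\<forall>x \<in> V - {u}. \<forall>y \<in> V - {u}. x \<noteq> y \<longrightarrow>
      (if mult ?L x u = y then mult ?L u x = y
       else mult ?L x (mult ?L u y) = mult ?L (mult ?L x u) y))"
  proof -
    have "carrier ?L - {one ?L, u} = V - {u}"
      using assms(2) by (auto simp: carrier one)
    moreover have "u \<in> carrier ?L" "u \<noteq> one ?L"
      using assms(2,3) by (auto simp: carrier one)
    ultimately show ?thesis
      using nucleus_iff_distinct_pairs[of u] by simp
  qed
  then show ?thesis
    using pair by simp
qed

end
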